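(* Let $\mathcal{H}$ be a real Hilbert space and $V:\mathcal{H}\to\mathcal{H}$ a monotone and continuous operator. Let $r\in(0,1]$, $\alpha,\theta>0$ be such that - if $r\in(0,1)$, then $\frac2\alpha<\theta$; - if $r=1$, then $\frac{2}{\alpha+1}\le\theta<\frac14$. Let $(\beta_k)_{k\ge0}$ be a positive, nondecreasing sequence such that for some positive integer $k_0$ $$\sup_{k\ge k_0}k^{r}\left(\frac{\beta_k-\beta_{k-1}}{\beta_k}+\frac{2r}{k}\right)<\frac{1}{2\theta}.$$ Let $z^0,z^1\in\mathcal{H}$ and let $(z^k)_{k\ge2}$ be generated by the implicit algorithm: for all $k\ge1$, $$z^{k+1}=z^k+\frac{k^{r}}{\alpha-rk^{r-1}+(k+1)^{r}}\bigl(z^k-z^{k-1}\bigr)-\frac{\theta k^{2r}\beta_{k-1}}{\alpha-rk^{r-1}+(k+1)^{r}}\bigl[V(z^{k+1})-V(z^k)\bigr]-\frac{\theta\bigl\{[(k+1)^{2r}-k^{2r}]-2rk^{2r-1}\bigr\}+k^{r}}{\alpha-rk^{r-1}+(k+1)^{r}}\,\beta_kV(z^{k+1}).$$ Let $z_*$ be a zero of $V$. For $\rho>0$ consider the following convergence rates as $k\to+\infty$: $$(R_\rho)\qquad \|V(z^k)\|=\mathcal{O}\left(\frac{1}{k^{\rho+r}\beta_k}\right),\quad \langle z^{k+1}-z_*,V(z^{k+1})\rangle=\mathcal{O}\left(\frac{1}{k^{2\rho}\beta_k}\right),\quad \|z^k-z^{k-1}\|=\mathcal{O}\left(\frac1{k^{\rho}}\right).$$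 Then: (i) If $r\in(0,1)$, then $(R_\rho)$ holds for every $\rho\in(0,r)$. Furthermore, if $(z^k)_{k\ge2}$ is bounded, then $(R_\rho)$ holds for $\rho=r$. (ii) If $r=1$, then $(z^k)_{k\ge2}$ is bounded; moreover, $(R_\rho)$ holds for $\rho=1$.
   Context: An operator $V:\mathcal{H}\to\mathcal{H}$ is monotone if $\langle V(x)-V(y),x-y\rangle\ge0$ for all $x,y\in\mathcal{H}$. A zero of $V$ is a point $z_*$ with $V(z_* )=0$. For positive $b_k$, $a_k=\mathcal{O}(b_k)$ as $k\to+\infty$ means $|a_k|/b_k$ is bounded for all large $k$. *)

theory Defs
  imports "HOL-Analysis.Analysis" "HOL-Library.Landau_Symbols"
begin

definition monotone_operator :: "('a::real_inner \<Rightarrow> 'a) \<Rightarrow> bool" where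
  "monotone_operator V \<longleftrightarrow> (\<forall>x y. inner (V x - V y) (x - y) \<ge> 0)"

(* The scheme is implicit: z (k + 1) occurs on both sides, so it is a relation on sequences
   rather than a recursive function. For k >= 1 and 0 < r <= 1, 0 < \<alpha> the denominator is
   positive and all bases of powr are positive. *)
definition implicit_algorithm ::
  "real \<Rightarrow> real \<Rightarrow> real \<Rightarrow> (nat \<Rightarrow> real) \<Rightarrow> ('a::real_inner \<Rightarrow> 'a) \<Rightarrow> (nat \<Rightarrow> 'a) \<Rightarrow> bool" where
  "implicit_algorithm r \<alpha> \<theta> \<beta> V z \<longleftrightarrow>
     (\<forall>k\<ge>1. let d = \<alpha> - r * real k powr (r - 1) + real (k + 1) powr r in
        z (k + 1) = z k
          + (real k powr r / d) *\<^sub>R (z k - z (k - 1))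
          - (\<theta> * real k powr (2 * r) * \<beta> (k - 1) / d) *\<^sub>R (V (z (k + 1)) - V (z k))
          - ((\<theta> * ((real (k + 1) powr (2 * r) - real k powr (2 * r))
                    - 2 * r * real k powr (2 * r - 1)) + real k powr r) / d * \<beta> k)
              *\<^sub>R V (z (k + 1)))"

definition convergence_rates ::
  "('a::real_inner \<Rightarrow> 'a) \<Rightarrow> (nat \<Rightarrow> real) \<Rightarrow> real \<Rightarrow> 'a \<Rightarrow> (nat \<Rightarrow> 'a) \<Rightarrow> real \<Rightarrow> bool" where
  "convergence_rates V \<beta> r zstar z \<rho> \<longleftrightarrow>
     (\<lambda>k. norm (V (z k))) \<in> O(\<lambda>k. 1 / (real k powr (\<rho> + r) * \<beta> k)) \<and>
     (\<lambda>k. inner (z (k + 1) - zstar) (V (z (k + 1)))) \<in> O(\<lambda>k. 1 / (real k powr (2 * \<rho>) * \<beta> k)) \<and>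
     (\<lambda>k. norm (z k - z (k - 1))) \<in> O(\<lambda>k. 1 / real k powr \<rho>)"

end

(* Put p k = k^r (z k - z (k-1)), q k = k^(2r) \<beta> (k-1) V (z k), m k = \<alpha> - r k^(r-1). The scheme says
     (p + \<theta> q) (k+1) - (p + \<theta> q) k = - m k (z (k+1) - z k) - k^r \<beta> k c k V (z (k+1)),
   where the growth condition on \<beta> amounts to 1/2 < c k <= 1. For a suitable constant l the energy
     |l (z - z* ) + p + (\<theta>/2) q|^2 / 2 + l (m - l)/2 |z - z*|^2 + l \<theta>/2 <z - z*, q> + (\<theta>^2/8) |q|^2
   with frozen coefficient m decreases up to a quadratic form in (z (k+1) - z k, V (z (k+1))) that is
   positive for large k; monotonicity of V gives every other remainder the right sign. As m k
   increases to a finite limit, dividing the energy by its coefficient l (m - l)/2 makes it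
   nonincreasing. Hence z, p, q and <z - z*, q> are bounded for all r in (0,1], which gives the rates
   with \<rho> = r, and a fortiori those with \<rho> < r. *)
theory Submission
  imports Defs "HOL-Real_Asymp.Real_Asymp"
begin

section \<open>One-step algebra of the energy\<close>

lemma quadratic_form_nonneg:
  fixes a b :: "'a::real_inner"
  assumes "0 < A" "X\<^sup>2 \<le> 4 * A * C"
  shows "0 \<le> A * (norm a)\<^sup>2 + X * inner a b + C * (norm b)\<^sup>2"
proof -
  have "4 * A * (A * (norm a)\<^sup>2 + X * inner a b + C * (norm b)\<^sup>2)
      = (norm ((2 * A) *\<^sub>R a + X *\<^sub>R b))\<^sup>2 + (4 * A * C - X\<^sup>2) * (norm b)\<^sup>2"
    unfolding power2_norm_eq_inner
    by (simp add: inner_add_left inner_add_right inner_commute[of b a] algebra_simps power2_eq_square)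
  also have "\<dots> \<ge> 0" using assms by simp
  finally show ?thesis using \<open>0 < A\<close> by (simp add: zero_le_mult_iff)
qed

text \<open>The weight \<open>w\<close> is a free argument, so that it can be frozen during a step
  and changed afterwards. All four summands are nonnegative once \<open>w\<close> and
  \<open>inner y q\<close> are.\<close>

definition energy :: "real \<Rightarrow> real \<Rightarrow> real \<Rightarrow> 'a::real_inner \<Rightarrow> 'a \<Rightarrow> 'a \<Rightarrow> real" where
  "energy l \<mu> w y p q = (norm (l *\<^sub>R y + p + \<mu> *\<^sub>R q))\<^sup>2 / 2 + w * (norm y)\<^sup>2
     + l * \<mu> * inner y q + \<mu>\<^sup>2 / 2 * (norm q)\<^sup>2"

text \<open>The coefficients of the energy are chosen for cancellation: the weight l (m - l) / 2
  removes the product of y' with y' - y, the term in \<open>inner y q\<close> that of y' with the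
  increment of q, and the last term that of the new q with its increment. What survives is squares,
  terms signed by monotonicity, and a form in y' - y and v'.\<close>

lemma energy_step:
  fixes y y' p v v' :: "'a::real_inner"
  assumes scheme: "K *\<^sub>R (y' - y) + (2 * \<mu> * B') *\<^sub>R v'
      = p + (2 * \<mu> * B) *\<^sub>R v - m *\<^sub>R (y' - y) - g *\<^sub>R v'"
    and "0 \<le> inner (y' - y) (v' - v)" and "0 \<le> inner y' v'"
    and "0 \<le> l" "l \<le> m" "0 \<le> \<mu>" "0 \<le> K" "0 \<le> B" "0 \<le> g"
  shows "energy l \<mu> (l * (m - l) / 2) y' (K *\<^sub>R (y' - y)) (B' *\<^sub>R v')
      + ((m - l) * K * (norm (y' - y))\<^sup>2
         + (K * g + \<mu> * K * (B' - B) + \<mu> * (m - l) * B' - l * \<mu> * B) * inner (y' - y) v'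
         + \<mu> * g * B' * (norm v')\<^sup>2)
      \<le> energy l \<mu> (l * (m - l) / 2) y p (B *\<^sub>R v)"
proof -
  define d where "d = y' - y"
  have y: "y = y' - d" by (simp add: d_def)
  have p: "p = K *\<^sub>R d + (2 * \<mu> * B') *\<^sub>R v' - (2 * \<mu> * B) *\<^sub>R v + m *\<^sub>R d + g *\<^sub>R v'"
    using scheme by (simp add: d_def algebra_simps)
  \<comment> \<open>By the scheme, \<open>W\<close> is the increment of
    \<open>l *\<^sub>R y + p + \<mu> *\<^sub>R q\<close> over the step.\<close>
  define W where "W = (l - m) *\<^sub>R d - g *\<^sub>R v' - \<mu> *\<^sub>R (B' *\<^sub>R v' - B *\<^sub>R v)"
  \<comment> \<open>Splitting the increment of q as (B' - B) v' + B (v' - v) sends its first part to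
    the quadratic form and leaves the second to monotonicity.\<close>
  have "energy l \<mu> (l * (m - l) / 2) y p (B *\<^sub>R v)
      - energy l \<mu> (l * (m - l) / 2) y' (K *\<^sub>R d) (B' *\<^sub>R v')
      - ((m - l) * K * (norm d)\<^sup>2
         + (K * g + \<mu> * K * (B' - B) + \<mu> * (m - l) * B' - l * \<mu> * B) * inner d v'
         + \<mu> * g * B' * (norm v')\<^sup>2)
    = (norm W)\<^sup>2 / 2 + l * (m - l) / 2 * (norm d)\<^sup>2
      + \<mu>\<^sup>2 / 2 * (norm (B' *\<^sub>R v' - B *\<^sub>R v))\<^sup>2
      + l * g * inner y' v' + (\<mu> * K * B + l * \<mu> * B) * inner d (v' - v)"
    unfolding energy_def y p W_def power2_norm_eq_inner
    by (simp add: inner_add_left inner_add_right inner_diff_left inner_diff_right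
        inner_commute[of d y'] inner_commute[of v y'] inner_commute[of v' y']
        inner_commute[of v d] inner_commute[of v' d] inner_commute[of v' v]
        field_simps power2_eq_square)
  moreover have "0 \<le> (norm W)\<^sup>2 / 2 + l * (m - l) / 2 * (norm d)\<^sup>2
      + \<mu>\<^sup>2 / 2 * (norm (B' *\<^sub>R v' - B *\<^sub>R v))\<^sup>2
      + l * g * inner y' v' + (\<mu> * K * B + l * \<mu> * B) * inner d (v' - v)"
    using assms(2-) unfolding d_def by (intro add_nonneg_nonneg mult_nonneg_nonneg) auto
  ultimately show ?thesis unfolding d_def by linarith
qed


text \<open>The quotient is |y|^2 plus a nonnegative quantity, free of the weight, divided by the
  weight. This absorbs the change of \<open>m\<close> from one step to the next.\<close>

lemma energy_div_mono:
  assumes "0 \<le> l" "0 \<le> \<mu>" "0 \<le> inner y q" "0 < w" "w \<le> w'"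
  shows "energy l \<mu> w' y p q / w' \<le> energy l \<mu> w y p q / w"
proof -
  define R where "R = energy l \<mu> 0 y p q"
  have eq: "energy l \<mu> u y p q / u = R / u + (norm y)\<^sup>2" if "0 < u" for u
    using that by (simp add: energy_def R_def field_simps)
  have "0 \<le> R" using assms by (simp add: R_def energy_def)
  then have "R / w' \<le> R / w" using assms by (intro divide_left_mono) auto
  then show ?thesis using assms eq by simp
qed

text \<open>Each nonnegative summand is at most C; p is then recovered from the first square by the
  triangle inequality.\<close>

lemma energy_bounds:
  assumes "0 < l" "0 < \<mu>" "0 \<le> inner y q" "0 < w" "energy l \<mu> w y p q \<le> C"
  shows "norm y \<le> sqrt (C / w)" "norm q \<le> sqrt (2 * C) / \<mu>" "inner y q \<le> C / (l * \<mu>)"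
    "norm p \<le> 2 * sqrt (2 * C) + l * sqrt (C / w)"
proof -
  define u where "u = l *\<^sub>R y + p + \<mu> *\<^sub>R q"
  have nn: "0 \<le> (norm u)\<^sup>2 / 2" "0 \<le> w * (norm y)\<^sup>2" "0 \<le> l * \<mu> * inner y q"
      "0 \<le> \<mu>\<^sup>2 / 2 * (norm q)\<^sup>2"
    using assms by auto
  have sum: "(norm u)\<^sup>2 / 2 + w * (norm y)\<^sup>2 + l * \<mu> * inner y q + \<mu>\<^sup>2 / 2 * (norm q)\<^sup>2 \<le> C"
    using assms(5) by (simp add: energy_def u_def)
  have "w * (norm y)\<^sup>2 \<le> C" using nn sum by linarith
  then have "(norm y)\<^sup>2 \<le> C / w" using \<open>0 < w\<close> by (simp add: field_simps)
  then show y: "norm y \<le> sqrt (C / w)" by (rule real_le_rsqrt)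
  have "\<mu>\<^sup>2 / 2 * (norm q)\<^sup>2 \<le> C" using nn sum by linarith
  then have "(\<mu> * norm q)\<^sup>2 \<le> 2 * C" by (simp add: power_mult_distrib)
  then have q: "\<mu> * norm q \<le> sqrt (2 * C)" by (rule real_le_rsqrt)
  then show "norm q \<le> sqrt (2 * C) / \<mu>" using \<open>0 < \<mu>\<close> by (simp add: field_simps)
  have "l * \<mu> * inner y q \<le> C" using nn sum by linarith
  then show "inner y q \<le> C / (l * \<mu>)" using assms(1,2) by (simp add: field_simps)
  have "(norm u)\<^sup>2 \<le> 2 * C" using nn sum by linarith
  then have u: "norm u \<le> sqrt (2 * C)" by (rule real_le_rsqrt)
  have "p = u - l *\<^sub>R y - \<mu> *\<^sub>R q" by (simp add: u_def)
  then have "norm p \<le> norm u + l * norm y + \<mu> * norm q"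
    using assms(1,2) norm_triangle_ineq4[of "u - l *\<^sub>R y" "\<mu> *\<^sub>R q"] norm_triangle_ineq4[of u "l *\<^sub>R y"]
    by simp
  also have "\<dots> \<le> sqrt (2 * C) + l * sqrt (C / w) + sqrt (2 * C)"
    using u y q assms(1) by (intro add_mono mult_left_mono) auto
  finally show "norm p \<le> 2 * sqrt (2 * C) + l * sqrt (C / w)" by simp
qed

section \<open>Asymptotics of powers and a numerical inequality\<close>

lemma powr_ratio_tendsto:
  assumes "0 < (r::real)"
  shows "(\<lambda>k. real k powr r / real (k + 1) powr r) \<longlonglongrightarrow> 1"
  using assms by real_asymp

text \<open>The two terms agree to leading order, both being about 2 r k^(r-1): they vanish for r <
  1 and tend to 2 for r = 1, hence the case split.\<close>

lemma powr_increment_tendsto: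
  assumes "0 < r" "r \<le> 1"
  shows "(\<lambda>k. (real (k + 1) powr (2 * r) - real k powr (2 * r)) / real (k + 1) powr r
      - 2 * r * (real k powr r / real k)) \<longlonglongrightarrow> 0"
proof (cases "r = 1")
  case True
  show ?thesis unfolding True by real_asymp
next
  case False
  then show ?thesis using assms by real_asymp
qed

text \<open>Since h^2 / 4 \<le> h / 4, a margin h / 4 \<ge> 1/10 is left for the error, which costs
  at most 1/20 + 1/400.\<close>

lemma perturbed_square_le:
  assumes "2 / 5 \<le> h" "h \<le> 1" "\<bar>e\<bar> \<le> 1 / 20"
  shows "(h / 2 + e)\<^sup>2 \<le> h / (2 :: real)"
proof -
  have "h * h \<le> h * 1" using assms by (intro mult_left_mono) auto
  moreover have "h * e \<le> h * \<bar>e\<bar>" "h * \<bar>e\<bar> \<le> 1 * (1/20)"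
    using assms by (intro mult_left_mono mult_mono'; simp)+
  moreover have "e\<^sup>2 \<le> 1 / 400" using power_mono[OF assms(3), of 2] by (simp add: power_divide)
  moreover have "(h / 2 + e)\<^sup>2 = h * h / 4 + h * e + e\<^sup>2"
    by (simp add: power2_eq_square algebra_simps)
  ultimately show ?thesis using assms(1) by linarith
qed

section \<open>The scheme in telescoping form\<close>

text \<open>\<open>damping\<close> is the common consequence of the two parameter conditions, and
  \<open>growth\<close> the termwise form of the supremum condition.\<close>

locale implicit_scheme =
  fixes V :: "'a::real_inner \<Rightarrow> 'a" and r \<alpha> \<theta> :: real and \<beta> :: "nat \<Rightarrow> real"
    and z :: "nat \<Rightarrow> 'a" and zstar :: 'a
  assumes mono: "monotone_operator V"
    and r: "0 < r" "r \<le> 1" and \<theta>: "0 < \<theta>" and \<alpha>: "0 < \<alpha>"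
    and \<beta>_pos: "0 < \<beta> k" and \<beta>_mono: "incseq \<beta>"
    and damping: "3 / 2 < \<theta> * (if r = 1 then \<alpha> - 1 else \<alpha>)"
    and growth: "\<forall>\<^sub>F k in sequentially.
       \<theta> * (real k powr r * ((\<beta> k - \<beta> (k - 1)) / \<beta> k + 2 * r / real k)) < 1 / 2"
    and algorithm: "implicit_algorithm r \<alpha> \<theta> \<beta> V z"
    and zero: "V zstar = 0"
begin

definition K where "K k = real k powr r"
definition B where "B k = (K k)\<^sup>2 * \<beta> (k - 1)"
definition m where "m k = \<alpha> - r * real k powr (r - 1)"
definition c where "c k = 1 - \<theta> * (K k * ((\<beta> k - \<beta> (k - 1)) / \<beta> k + 2 * r / real k))"
definition m_lim where "m_lim = (if r = 1 then \<alpha> - 1 else \<alpha>)"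
(* With this l the cross coefficient of the limiting quadratic form is c/2; see X_tendsto. *)
definition l where "l = (m_lim + 1 / \<theta>) / 2"
definition w where "w k = l * (m k - l) / 2"
definition F where
  "F k = energy l (\<theta> / 2) (w k) (z k - zstar) (K k *\<^sub>R (z k - z (k - 1))) (B k *\<^sub>R V (z k))"

lemma K_pos: "1 \<le> k \<Longrightarrow> 0 < K k" by (simp add: K_def)

lemma K_square: "(K k)\<^sup>2 = real k powr (2 * r)"
  by (simp add: K_def power2_eq_square flip: powr_add)

lemma B_nonneg: "0 \<le> B k" using \<beta>_pos[of "k - 1"] by (simp add: B_def)

lemma \<beta>_step: "\<beta> (k - 1) \<le> \<beta> k" using \<beta>_mono by (simp add: incseq_def)

lemma c_le_1: "c k \<le> 1"
  using \<beta>_step[of k] \<beta>_pos[of k] \<theta> r by (simp add: c_def K_def)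

lemma l_pos: "0 < l"
proof -
  have "0 < \<theta> * m_lim" using damping by (simp add: m_lim_def)
  then have "0 < m_lim" using \<theta> by (simp add: zero_less_mult_iff)
  then show ?thesis using \<theta> by (simp add: l_def add_pos_pos)
qed

lemma inner_V_nonneg: "0 \<le> inner (z k - zstar) (V (z k))"
  using mono zero unfolding monotone_operator_def by (metis diff_zero inner_commute)

text \<open>The denominator is \<open>m k + K (k + 1)\<close>, so clearing it puts
  \<open>K (k + 1)\<close> on the left and the friction \<open>m k\<close> on the right.\<close>

lemma scheme:
  assumes "1 \<le> k"
  shows "K (k + 1) *\<^sub>R (z (k + 1) - z k) + (\<theta> * B (k + 1)) *\<^sub>R V (z (k + 1))
    = K k *\<^sub>R (z k - z (k - 1)) + (\<theta> * B k) *\<^sub>R V (z k) - m k *\<^sub>R (z (k + 1) - z k)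
      - (K k * \<beta> k * c k) *\<^sub>R V (z (k + 1))"
proof -
  define d where "d = \<alpha> - r * real k powr (r - 1) + real (k + 1) powr r"
  define E where "E = \<theta> * ((real (k + 1) powr (2 * r) - real k powr (2 * r))
                    - 2 * r * real k powr (2 * r - 1)) + real k powr r"
  have "real k powr (r - 1) \<le> real k powr 0" using assms r by (intro powr_mono) auto
  then have "r * real k powr (r - 1) \<le> 1 * 1" using r assms by (intro mult_mono) auto
  moreover have "1 \<le> real (k + 1) powr r" using r by (intro ge_one_powr_ge_zero) auto
  ultimately have "0 < d" using \<alpha> by (simp add: d_def)
  have "z (k + 1) = z k
          + (real k powr r / d) *\<^sub>R (z k - z (k - 1))
          - (\<theta> * real k powr (2 * r) * \<beta> (k - 1) / d) *\<^sub>R (V (z (k + 1)) - V (z k))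
          - (E / d * \<beta> k) *\<^sub>R V (z (k + 1))"
    using algorithm assms unfolding implicit_algorithm_def Let_def d_def E_def by blast
  moreover have "x - a = b - c - e" if "x = a + b - c - e" for x a b c e :: 'a
    using that by (simp add: algebra_simps)
  ultimately have "z (k + 1) - z k = (K k / d) *\<^sub>R (z k - z (k - 1))
          - (\<theta> * B k / d) *\<^sub>R (V (z (k + 1)) - V (z k))
          - (E / d * \<beta> k) *\<^sub>R V (z (k + 1))"
    unfolding B_def mult.assoc[symmetric] unfolding K_square unfolding K_def by blast
  then have *: "d *\<^sub>R (z (k + 1) - z k) = K k *\<^sub>R (z k - z (k - 1))
          - (\<theta> * B k) *\<^sub>R (V (z (k + 1)) - V (z k)) - (E * \<beta> k) *\<^sub>R V (z (k + 1))"
    using \<open>0 < d\<close> by (simp only: scaleR_right_diff_distrib scaleR_scaleR) simp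
  have "real k powr (2 * r - 1) = (K k)\<^sup>2 / real k"
    using assms K_square[of k] by (simp add: powr_diff)
  \<comment> \<open>The powers of k + 1 in \<open>E\<close> cancel against
    \<open>\<theta> * B (k + 1)\<close>; this is what the correction term of the algorithm is built
    for.\<close>
  then have coeff: "K k * \<beta> k * c k = E * \<beta> k - \<theta> * (B (k + 1) - B k)"
    using \<beta>_pos[of k] assms unfolding E_def K_square[symmetric] c_def B_def
    by (simp add: K_def field_simps power2_eq_square)
  have "d = m k + K (k + 1)" by (simp add: d_def m_def K_def)
  with * show ?thesis unfolding coeff by (simp add: algebra_simps)
qed

section \<open>Limits of the coefficients and the discriminant condition\<close>

lemma m_mono: "1 \<le> k \<Longrightarrow> m k \<le> m (k + 1)"
  unfolding m_def using r by (auto intro!: mult_left_mono powr_mono2')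

lemma m_tendsto: "m \<longlonglongrightarrow> m_lim"
proof (cases "r = 1")
  case True
  \<comment> \<open>Equality starts at k = 1 only, because \<open>0 powr 0\<close> is 0.\<close>
  have "\<forall>\<^sub>F k in sequentially. m k = m_lim"
    using eventually_gt_at_top[of 0] unfolding m_def m_lim_def
    unfolding True by eventually_elim simp
  then show ?thesis by (rule tendsto_eventually)
next
  case False
  then have "(\<lambda>k. \<alpha> - r * real k powr (r - 1)) \<longlonglongrightarrow> \<alpha>" using r by real_asymp
  then show ?thesis using False by (simp add: m_def[abs_def] m_lim_def)
qed

definition D where "D k = (B (k + 1) - B k) / (K (k + 1) * \<beta> k)"

text \<open>\<open>D\<close> is the increment of \<open>B\<close>, scaled to be comparable with (1 -
  c) / \<theta>. The difference consists of a bounded sequence times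
  \<open>K k / K (k + 1) - 1\<close> and of the error in
  \<open>powr_increment_tendsto\<close>.\<close>

lemma D_tendsto: "(\<lambda>k. \<theta> * D k - (1 - c k)) \<longlonglongrightarrow> 0"
proof -
  define u where "u k = K k * ((\<beta> k - \<beta> (k - 1)) / \<beta> k)" for k
  \<comment> \<open>Both summands in \<open>growth\<close> are nonnegative, so the \<beta> part
    alone obeys the bound.\<close>
  have "\<forall>\<^sub>F k in sequentially. norm (u k) \<le> 1 / (2 * \<theta>)"
    using growth eventually_gt_at_top[of 0]
  proof eventually_elim
    case (elim k)
    have "0 \<le> u k" using \<beta>_step[of k] \<beta>_pos[of k] by (simp add: u_def K_def)
    moreover have "0 \<le> K k * (2 * r / real k)" using r by (simp add: K_def)
    moreover have "\<theta> * (u k + K k * (2 * r / real k)) < 1 / 2"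
      using elim(1) by (simp add: u_def K_def algebra_simps)
    ultimately have "\<theta> * u k \<le> 1 / 2"
      using \<theta> by (smt (verit) mult_left_mono)
    then show ?case using \<theta> \<open>0 \<le> u k\<close> by (simp add: field_simps)
  qed
  then have Bu: "Bseq u" by (rule BfunI)
  have "(\<lambda>k. K k / K (k + 1) - 1) \<longlonglongrightarrow> 1 - 1"
    using powr_ratio_tendsto[OF r(1)] unfolding K_def by (intro tendsto_intros)
  then have "Zfun (\<lambda>k. K k / K (k + 1) - 1) sequentially" by (simp add: tendsto_Zfun_iff)
  then have "Zfun (\<lambda>k. (K k / K (k + 1) - 1) * u k) sequentially"
    using Bu bounded_bilinear.Zfun_prod_Bfun[OF bounded_bilinear_mult] by blast
  then have "(\<lambda>k. (K k / K (k + 1) - 1) * u k) \<longlonglongrightarrow> 0" by (simp add: tendsto_Zfun_iff)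
  from tendsto_mult[OF tendsto_const[of \<theta>] tendsto_add[OF this powr_increment_tendsto[OF r]]]
  have "(\<lambda>k. \<theta> * ((K k / K (k + 1) - 1) * u k + (((K (k + 1))\<^sup>2 - (K k)\<^sup>2) / K (k + 1)
      - 2 * r * (K k / real k)))) \<longlonglongrightarrow> 0" unfolding K_square[symmetric] by (simp add: K_def)
  then show ?thesis
  proof (rule Lim_transform_eventually)
    show "\<forall>\<^sub>F k in sequentially. \<theta> * ((K k / K (k + 1) - 1) * u k
      + (((K (k + 1))\<^sup>2 - (K k)\<^sup>2) / K (k + 1) - 2 * r * (K k / real k)))
      = \<theta> * D k - (1 - c k)"
      using eventually_gt_at_top[of 0]
    proof eventually_elim
      case (elim k)
      then show ?case using K_pos[of k] K_pos[of "k + 1"] \<beta>_pos[of k]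
        unfolding D_def c_def u_def B_def by (simp add: field_simps power2_eq_square)
    qed
  qed
qed

lemma c_ge_half: "\<forall>\<^sub>F k in sequentially. 1 / 2 < c k"
  using growth by eventually_elim (simp add: c_def K_def)

lemma c_Bseq: "Bseq c"
proof (rule BfunI)
  show "\<forall>\<^sub>F k in sequentially. norm (c k) \<le> 1"
    using c_ge_half by eventually_elim (use c_le_1 in auto)
qed

lemma inverse_K_tendsto: "(\<lambda>k. 1 / K (k + 1)) \<longlonglongrightarrow> 0"
  unfolding K_def using r(1) by real_asymp

lemma Bseq_mult_tendsto:
  assumes "Bseq u" "x \<longlonglongrightarrow> 0"
  shows "(\<lambda>k. u k * x k :: real) \<longlonglongrightarrow> 0"
  using bounded_bilinear.Bfun_prod_Zfun[OF bounded_bilinear_mult assms(1)] assms(2)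
  by (simp add: tendsto_Zfun_iff)

(* After rescaling V (z (k+1)) by K (k+1) \<beta> k and dividing by K (k+1), the quadratic form of
   energy_step has coefficients m - l, X and (\<theta>/2) h. *)
definition h where "h k = c k * (K k / K (k + 1))"
definition X where
  "X k = h k + \<theta> / 2 * (D k + m k - 2 * l + l * D k / K (k + 1))"

text \<open>Replacing \<theta> D by 1 - c and m by its limit 2 l - 1 / \<theta> turns X into h + (1
  - c) / 2 - 1/2 = h - c / 2, up to the term with 1 / \<open>K (k + 1)\<close>, which vanishes; and
  h - c tends to 0.\<close>

lemma X_tendsto: "(\<lambda>k. X k - h k / 2) \<longlonglongrightarrow> 0"
proof -
  have "(\<lambda>k. K k / K (k + 1) - 1) \<longlonglongrightarrow> 1 - 1"
    using powr_ratio_tendsto[OF r(1)] unfolding K_def by (intro tendsto_intros)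
  then have 1: "(\<lambda>k. c k * (K k / K (k + 1) - 1)) \<longlonglongrightarrow> 0"
    using Bseq_mult_tendsto[OF c_Bseq] by simp
  have 2: "(\<lambda>k. (\<theta> * D k - (1 - c k)) * (1 / K (k + 1))) \<longlonglongrightarrow> 0 * 0"
    by (intro tendsto_mult D_tendsto inverse_K_tendsto)
  have 3: "(\<lambda>k. 1 / K (k + 1) - c k * (1 / K (k + 1))) \<longlonglongrightarrow> 0 - 0"
    by (intro tendsto_diff Bseq_mult_tendsto c_Bseq inverse_K_tendsto)
  have 4: "(\<lambda>k. m k - m_lim) \<longlonglongrightarrow> m_lim - m_lim"
    by (intro tendsto_intros m_tendsto)
  note tendsto_add[OF tendsto_add[OF tendsto_add[OF
      tendsto_mult_left[where c = "1 / 2", OF 1] tendsto_mult_left[where c = "1 / 2", OF D_tendsto]]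
      tendsto_mult_left[where c = "\<theta> / 2", OF 4]]
      tendsto_mult_left[where c = "l / 2", OF tendsto_add[OF 2 3]]]
  moreover have "X k - h k / 2 = 1 / 2 * (c k * (K k / K (k + 1) - 1)) + 1 / 2 * (\<theta> * D k - (1 - c k))
      + \<theta> / 2 * (m k - m_lim) + l / 2 * ((\<theta> * D k - (1 - c k)) * (1 / K (k + 1))
        + (1 / K (k + 1) - c k * (1 / K (k + 1))))" for k
  proof -
    have m_lim: "m_lim = 2 * l - 1 / \<theta>" by (simp add: l_def field_simps)
    show ?thesis unfolding X_def h_def m_lim using K_pos[of "k + 1"] \<theta> by (simp add: field_simps)
  qed
  ultimately show ?thesis by simp
qed

text \<open>In the limit 2 \<theta> (m - l) equals \<theta> \<open>m_lim\<close> - 1, which exceeds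
  1/2 exactly when \<theta> \<open>m_lim\<close> > 3/2.\<close>

lemma damping_eventually: "\<forall>\<^sub>F k in sequentially. 1 / 2 \<le> 2 * \<theta> * (m k - l)"
proof -
  have "3 / 2 < \<theta> * m_lim" using damping by (simp add: m_lim_def)
  moreover have "\<theta> * (2 * l) = \<theta> * m_lim + 1" using \<theta> by (simp add: l_def field_simps)
  ultimately have "1 / 2 < 2 * \<theta> * (m_lim - l)" by (simp add: algebra_simps)
  moreover have "(\<lambda>k. 2 * \<theta> * (m k - l)) \<longlonglongrightarrow> 2 * \<theta> * (m_lim - l)"
    by (intro tendsto_intros m_tendsto)
  ultimately have "\<forall>\<^sub>F k in sequentially. 1 / 2 < 2 * \<theta> * (m k - l)"
    by (rule order_tendstoD(1)[rotated])
  then show ?thesis by eventually_elim simp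
qed

text \<open>By \<open>damping_eventually\<close> it suffices that X^2 \<le> h / 2, and X is close to
  h / 2.\<close>

lemma discriminant_eventually: "\<forall>\<^sub>F k in sequentially. (X k)\<^sup>2 \<le> 2 * \<theta> * (m k - l) * h k"
proof -
  have "\<forall>\<^sub>F k in sequentially. \<bar>X k - h k / 2\<bar> < 1 / 20"
    using tendstoD[OF X_tendsto, of "1 / 20"] by simp
  \<comment> \<open>Together with c > 1/2 this gives the lower bound 2/5 on h.\<close>
  moreover have "\<forall>\<^sub>F k in sequentially. 4 / 5 < K k / K (k + 1)"
    using order_tendstoD(1)[OF powr_ratio_tendsto[OF r(1)], of "4 / 5"] by (simp add: K_def)
  ultimately show ?thesis using c_ge_half damping_eventually eventually_gt_at_top[of 0]
  proof eventually_elim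
    case (elim k)
    have "K k \<le> K (k + 1)" using r by (auto simp: K_def intro!: powr_mono2)
    then have K1: "K k / K (k + 1) \<le> 1" using K_pos[of "k + 1"] by simp
    have "0 \<le> K k / K (k + 1)" by (simp add: K_def)
    then have "h k \<le> 1 * 1" unfolding h_def using c_le_1 K1 elim by (intro mult_mono) auto
    moreover have "1 / 2 * (4 / 5) \<le> h k" unfolding h_def using elim by (intro mult_mono) auto
    ultimately have "(h k / 2 + (X k - h k / 2))\<^sup>2 \<le> h k / 2"
      using elim by (intro perturbed_square_le) auto
    also have "h k / 2 = 1 / 2 * h k" by simp
    also have "\<dots> \<le> 2 * \<theta> * (m k - l) * h k"
      using elim \<open>1 / 2 * (4 / 5) \<le> h k\<close> by (intro mult_right_mono) auto
    finally show ?case by simp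
  qed
qed

section \<open>Decay of the energy and boundedness\<close>

lemma F_decreasing: "\<forall>\<^sub>F k in sequentially. F (k + 1) / w (k + 1) \<le> F k / w k"
  using discriminant_eventually c_ge_half damping_eventually eventually_gt_at_top[of 0]
proof eventually_elim
  case (elim k)
  define b where "b = \<beta> k"
  have b: "0 < b" by (simp add: b_def \<beta>_pos)
  have Kk: "0 < K k" "0 < K (k + 1)" using elim K_pos by auto
  have "0 < 2 * \<theta> * (m k - l)" using elim by linarith
  then have ml: "0 < m k - l" using \<theta> by (simp add: zero_less_mult_iff)
  then have w_pos: "0 < w k" using l_pos by (simp add: w_def)
  \<comment> \<open>The index shift in \<open>B\<close> makes \<beta> k the only value of \<beta>
    here; \<beta> (k - 1) is hidden in \<open>D k\<close>.\<close>
  have B': "B (k + 1) = (K (k + 1))\<^sup>2 * b" by (simp add: B_def b_def)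
  have B: "B k = (K (k + 1))\<^sup>2 * b - K (k + 1) * b * D k"
    using Kk b B' by (simp add: D_def b_def)
  have g: "K k * b * c k = K (k + 1) * b * h k" using Kk by (simp add: h_def)
  have X: "K (k + 1) * (K k * b * c k) + \<theta> / 2 * K (k + 1) * (B (k + 1) - B k)
      + \<theta> / 2 * (m k - l) * B (k + 1) - l * (\<theta> / 2) * B k = (K (k + 1))\<^sup>2 * b * X k"
    unfolding g unfolding B' B X_def using Kk by (simp add: field_simps power2_eq_square)
  have "((K (k + 1))\<^sup>2 * b * X k)\<^sup>2 = (K (k + 1))^4 * b\<^sup>2 * (X k)\<^sup>2"
    by (simp add: power_mult_distrib flip: power_mult)
  also have "\<dots> \<le> (K (k + 1))^4 * b\<^sup>2 * (2 * \<theta> * (m k - l) * h k)"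
    using elim by (intro mult_left_mono) auto
  also have "\<dots> = 4 * ((m k - l) * K (k + 1)) * (\<theta> / 2 * (K k * b * c k) * B (k + 1))"
    unfolding g B' by (simp add: power4_eq_xxxx power2_eq_square)
  finally have form: "0 \<le> (m k - l) * K (k + 1) * (norm ((z (k + 1) - zstar) - (z k - zstar)))\<^sup>2
      + (K (k + 1) * (K k * b * c k) + \<theta> / 2 * K (k + 1) * (B (k + 1) - B k)
          + \<theta> / 2 * (m k - l) * B (k + 1) - l * (\<theta> / 2) * B k)
        * inner ((z (k + 1) - zstar) - (z k - zstar)) (V (z (k + 1)))
      + \<theta> / 2 * (K k * b * c k) * B (k + 1) * (norm (V (z (k + 1))))\<^sup>2"
    unfolding X using ml Kk by (intro quadratic_form_nonneg) auto
  \<comment> \<open>The weight is still \<open>w k\<close> at the new point, so this is not yet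
    \<open>F (k + 1)\<close>; \<open>energy_div_mono\<close> makes the exchange below.\<close>
  have "energy l (\<theta> / 2) (w k) (z (k + 1) - zstar)
      (K (k + 1) *\<^sub>R ((z (k + 1) - zstar) - (z k - zstar))) (B (k + 1) *\<^sub>R V (z (k + 1)))
    + ((m k - l) * K (k + 1) * (norm ((z (k + 1) - zstar) - (z k - zstar)))\<^sup>2
      + (K (k + 1) * (K k * b * c k) + \<theta> / 2 * K (k + 1) * (B (k + 1) - B k)
          + \<theta> / 2 * (m k - l) * B (k + 1) - l * (\<theta> / 2) * B k)
        * inner ((z (k + 1) - zstar) - (z k - zstar)) (V (z (k + 1)))
      + \<theta> / 2 * (K k * b * c k) * B (k + 1) * (norm (V (z (k + 1))))\<^sup>2)
    \<le> F k"
    unfolding F_def w_def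
  proof (rule energy_step)
    show "K (k + 1) *\<^sub>R ((z (k + 1) - zstar) - (z k - zstar))
        + (2 * (\<theta> / 2) * B (k + 1)) *\<^sub>R V (z (k + 1))
      = K k *\<^sub>R (z k - z (k - 1)) + (2 * (\<theta> / 2) * B k) *\<^sub>R V (z k)
        - m k *\<^sub>R ((z (k + 1) - zstar) - (z k - zstar)) - (K k * b * c k) *\<^sub>R V (z (k + 1))"
      using scheme[of k] elim by (simp add: b_def)
    show "0 \<le> inner ((z (k + 1) - zstar) - (z k - zstar)) (V (z (k + 1)) - V (z k))"
      using mono by (simp add: monotone_operator_def inner_commute)
  qed (use inner_V_nonneg l_pos ml \<theta> Kk B_nonneg b elim in auto)
  then have step: "energy l (\<theta> / 2) (w k) (z (k + 1) - zstar)
      (K (k + 1) *\<^sub>R (z (k + 1) - z k)) (B (k + 1) *\<^sub>R V (z (k + 1))) \<le> F k"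
    using form by simp
  have "w k \<le> w (k + 1)" unfolding w_def using m_mono[of k] elim l_pos by simp
  then have "F (k + 1) / w (k + 1) \<le> energy l (\<theta> / 2) (w k) (z (k + 1) - zstar)
      (K (k + 1) *\<^sub>R (z (k + 1) - z k)) (B (k + 1) *\<^sub>R V (z (k + 1))) / w k"
    unfolding F_def add_diff_cancel_right' using l_pos \<theta> w_pos inner_V_nonneg B_nonneg
    by (intro energy_div_mono) auto
  also have "\<dots> \<le> F k / w k" using step w_pos by (intro divide_right_mono) auto
  finally show ?case .
qed

text \<open>Two-sided bounds turn control of \<open>F k / w k\<close> into control of
  \<open>F k\<close> and of each summand, uniformly in k. The lower one comes from m - l \<ge> 1 /
  (4 \<theta>), the upper one from m \<le> \<alpha>.\<close>

lemma w_bounds: "\<forall>\<^sub>F k in sequentially. l / (8 * \<theta>) \<le> w k \<and> w k \<le> l * \<alpha> / 2"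
  using damping_eventually
proof eventually_elim
  case (elim k)
  have "l * (1 / (4 * \<theta>)) \<le> l * (m k - l)" "l * (m k - l) \<le> l * \<alpha>"
    using elim \<theta> l_pos r by (intro mult_left_mono; simp add: field_simps m_def)+
  then show ?case by (simp add: w_def)
qed

lemma bounds:
  obtains M where "\<forall>\<^sub>F k in sequentially. norm (z k - zstar) \<le> M \<and>
    K k * norm (z k - z (k - 1)) \<le> M \<and> B k * norm (V (z k)) \<le> M \<and>
    B k * inner (z k - zstar) (V (z k)) \<le> M"
proof -
  have "\<forall>\<^sub>F k in sequentially. F (k + 1) / w (k + 1) \<le> F k / w k \<and> 0 < w k"
    using F_decreasing w_bounds
    by eventually_elim (use l_pos \<theta> in \<open>auto intro: less_le_trans[of 0 "l / (8 * \<theta>)"]\<close>)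
  then obtain N where N: "\<And>k. N \<le> k \<Longrightarrow> F (k + 1) / w (k + 1) \<le> F k / w k \<and> 0 < w k"
    unfolding eventually_sequentially by blast
  have dec: "F k / w k \<le> F N / w N" if "N \<le> k" for k
    using that by (induction rule: dec_induct) (use N in fastforce)+
  have F_nonneg: "0 \<le> F k" if "N \<le> k" for k
    using N[OF that] l_pos \<theta> inner_V_nonneg B_nonneg by (simp add: F_def energy_def)
  define C where "C = F N / w N * (l * \<alpha> / 2)"
  define M where "M = Max {sqrt (C / (l / (8 * \<theta>))), sqrt (2 * C) / (\<theta> / 2),
      C / (l * (\<theta> / 2)), 2 * sqrt (2 * C) + l * sqrt (C / (l / (8 * \<theta>)))}"
  have "\<forall>\<^sub>F k in sequentially. F k \<le> C"
    using w_bounds eventually_ge_at_top[of N]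
  proof eventually_elim
    case (elim k)
    have "F k = F k / w k * w k" using N[of k] elim by simp
    also have "\<dots> \<le> F N / w N * (l * \<alpha> / 2)"
      using elim dec[of k] N[of k] N[of N] F_nonneg[of N] by (intro mult_mono) auto
    finally show ?case by (simp add: C_def)
  qed
  then have "\<forall>\<^sub>F k in sequentially. norm (z k - zstar) \<le> M \<and>
    K k * norm (z k - z (k - 1)) \<le> M \<and> B k * norm (V (z k)) \<le> M \<and>
    B k * inner (z k - zstar) (V (z k)) \<le> M"
    using w_bounds
  proof eventually_elim
    case (elim k)
    \<comment> \<open>The weight occurs only in front of |y|^2, so its uniform lower bound may
      replace it and the resulting constants do not depend on k.\<close>
    have "energy l (\<theta> / 2) (l / (8 * \<theta>)) (z k - zstar) (K k *\<^sub>R (z k - z (k - 1)))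
       (B k *\<^sub>R V (z k)) \<le> F k"
      using elim mult_right_mono[of "l / (8 * \<theta>)" "w k" "(norm (z k - zstar))\<^sup>2"]
      by (simp add: F_def energy_def)
    with elim have "energy l (\<theta> / 2) (l / (8 * \<theta>)) (z k - zstar) (K k *\<^sub>R (z k - z (k - 1)))
       (B k *\<^sub>R V (z k)) \<le> C" by linarith
    from energy_bounds[OF _ _ _ _ this] l_pos \<theta> inner_V_nonneg[of k] B_nonneg[of k]
    have "norm (z k - zstar) \<le> sqrt (C / (l / (8 * \<theta>)))"
      "B k * norm (V (z k)) \<le> sqrt (2 * C) / (\<theta> / 2)"
      "B k * inner (z k - zstar) (V (z k)) \<le> C / (l * (\<theta> / 2))"
      "K k * norm (z k - z (k - 1)) \<le> 2 * sqrt (2 * C) + l * sqrt (C / (l / (8 * \<theta>)))"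
      by (simp_all add: K_def)
    then show ?case unfolding M_def by (auto intro: order_trans[OF _ Max_ge])
  qed
  then show ?thesis by (rule that)
qed

lemma bounded_iterates: "bounded (range z)"
proof -
  obtain M where "\<forall>\<^sub>F k in sequentially. norm (z k - zstar) \<le> M \<and>
    K k * norm (z k - z (k - 1)) \<le> M \<and> B k * norm (V (z k)) \<le> M \<and>
    B k * inner (z k - zstar) (V (z k)) \<le> M" by (rule bounds)
  then have "\<forall>\<^sub>F k in sequentially. norm (z k - zstar) \<le> M" by eventually_elim simp
  then have "Bseq (\<lambda>k. z k - zstar)" by (rule BfunI)
  then have "Bseq z" using Bseq_add[of "\<lambda>k. z k - zstar" zstar] by simp
  then show ?thesis by (simp add: Bseq_eq_bounded)
qed

section \<open>Convergence rates\<close>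

text \<open>Converts \<beta> (k - 1) in \<open>B k\<close> into the \<beta> k of the rates. By
  \<open>growth\<close> the relative increment of \<beta> is below 1 / (2 \<theta> k^r), hence below
  1/2 once \<theta> k^r > 1.\<close>

lemma \<beta>_ratio: "\<forall>\<^sub>F k in sequentially. \<beta> k \<le> 2 * \<beta> (k - 1)"
proof -
  have "(\<lambda>k. 1 / (2 * \<theta>) * (1 / K (k + 1))) \<longlonglongrightarrow> 1 / (2 * \<theta>) * 0"
    by (intro tendsto_intros inverse_K_tendsto)
  then have "\<forall>\<^sub>F k in sequentially. 1 / (2 * \<theta>) * (1 / K (k + 1)) < 1 / 2"
    by (rule order_tendstoD(2)) simp
  then have "\<forall>\<^sub>F k in sequentially. 1 / (2 * \<theta>) * (1 / K (k - 1 + 1)) < 1 / 2"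
    using filterlim_minus_const_nat_at_top[of 1] by (rule eventually_compose_filterlim)
  then show ?thesis using growth eventually_gt_at_top[of 0]
  proof eventually_elim
    case (elim k)
    then have K: "0 < K k" and K_large: "1 < \<theta> * K k"
      using K_pos[of k] \<theta> by (auto simp: field_simps)
    define x where "x = (\<beta> k - \<beta> (k - 1)) / \<beta> k"
    have "0 \<le> x" using \<beta>_step[of k] \<beta>_pos[of k] by (simp add: x_def)
    have "1 * x \<le> \<theta> * K k * x"
      using K_large \<open>0 \<le> x\<close> by (intro mult_right_mono) auto
    also have "\<dots> \<le> \<theta> * (K k * (x + 2 * r / real k))"
      using \<theta> K r by (simp add: algebra_simps)
    also have "\<dots> < 1 / 2" using elim by (simp add: x_def K_def)
    finally show ?case using \<beta>_pos[of k] by (simp add: x_def field_simps)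
  qed
qed

lemma rates:
  assumes "\<rho> \<le> r"
  shows "convergence_rates V \<beta> r zstar z \<rho>"
proof -
  obtain M where M: "\<forall>\<^sub>F k in sequentially. norm (z k - zstar) \<le> M \<and>
    K k * norm (z k - z (k - 1)) \<le> M \<and> B k * norm (V (z k)) \<le> M \<and>
    B k * inner (z k - zstar) (V (z k)) \<le> M" by (rule bounds)
  have "(\<lambda>k. norm (V (z k))) \<in> O(\<lambda>k. 1 / (real k powr (\<rho> + r) * \<beta> k))"
  proof (rule bigoI[of _ "2 * M"])
    show "\<forall>\<^sub>F k in sequentially. norm (norm (V (z k)))
        \<le> 2 * M * norm (1 / (real k powr (\<rho> + r) * \<beta> k))"
      using M \<beta>_ratio eventually_gt_at_top[of 0]
    proof eventually_elim
      case (elim k)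
      have "real k powr (\<rho> + r) \<le> real k powr (2 * r)" using assms elim by (intro powr_mono) auto
      also have "\<dots> = (K k)\<^sup>2" by (simp add: K_square)
      finally have "real k powr (\<rho> + r) * \<beta> k \<le> (K k)\<^sup>2 * (2 * \<beta> (k - 1))"
        using elim \<beta>_pos[of k] by (intro mult_mono) auto
      then have "real k powr (\<rho> + r) * \<beta> k * norm (V (z k)) \<le> 2 * (B k * norm (V (z k)))"
        by (auto simp: B_def dest: mult_right_mono[of _ _ "norm (V (z k))"])
      also have "\<dots> \<le> 2 * M" using elim by simp
      finally show ?case using elim \<beta>_pos[of k] by (simp add: field_simps)
    qed
  qed
  moreover have "(\<lambda>k. inner (z (k + 1) - zstar) (V (z (k + 1))))
      \<in> O(\<lambda>k. 1 / (real k powr (2 * \<rho>) * \<beta> k))"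
  \<comment> \<open>At index k + 1 the weight \<open>B (k + 1)\<close> already contains \<beta> k,
    so no factor 2 appears.\<close>
  proof (rule bigoI[of _ M])
    have "\<forall>\<^sub>F k in sequentially. B (k + 1) * inner (z (k + 1) - zstar) (V (z (k + 1))) \<le> M"
      using eventually_compose_filterlim[OF M filterlim_add_const_nat_at_top[of 1]]
      by eventually_elim simp
    then show "\<forall>\<^sub>F k in sequentially. norm (inner (z (k + 1) - zstar) (V (z (k + 1))))
        \<le> M * norm (1 / (real k powr (2 * \<rho>) * \<beta> k))"
      using eventually_gt_at_top[of 0]
    proof eventually_elim
      case (elim k)
      have "real k powr (2 * \<rho>) \<le> real k powr (2 * r)" using assms elim by (intro powr_mono) auto
      also have "\<dots> \<le> real (k + 1) powr (2 * r)" using r by (intro powr_mono2) auto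
      also have "\<dots> = (K (k + 1))\<^sup>2" by (simp add: K_square)
      finally have "real k powr (2 * \<rho>) * \<beta> k \<le> B (k + 1)"
        using \<beta>_pos[of k] by (simp add: B_def)
      then have "real k powr (2 * \<rho>) * \<beta> k * inner (z (k + 1) - zstar) (V (z (k + 1)))
          \<le> B (k + 1) * inner (z (k + 1) - zstar) (V (z (k + 1)))"
        using inner_V_nonneg by (rule mult_right_mono)
      also have "\<dots> \<le> M" using elim by simp
      finally show ?case using elim \<beta>_pos[of k] inner_V_nonneg[of "k + 1"]
        by (simp add: field_simps)
    qed
  qed
  moreover have "(\<lambda>k. norm (z k - z (k - 1))) \<in> O(\<lambda>k. 1 / real k powr \<rho>)"
  proof (rule bigoI[of _ M])
    show "\<forall>\<^sub>F k in sequentially. norm (norm (z k - z (k - 1))) \<le> M * norm (1 / real k powr \<rho>)"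
      using M eventually_gt_at_top[of 0]
    proof eventually_elim
      case (elim k)
      have "real k powr \<rho> \<le> K k" unfolding K_def using assms elim by (intro powr_mono) auto
      then have "real k powr \<rho> * norm (z k - z (k - 1)) \<le> K k * norm (z k - z (k - 1))"
        by (rule mult_right_mono) simp
      also have "\<dots> \<le> M" using elim by simp
      finally show ?case using elim by (simp add: field_simps)
    qed
  qed
  ultimately show ?thesis unfolding convergence_rates_def by blast
qed

end

theorem theorem3p3:
  fixes V :: "'a::{real_inner, complete_space} \<Rightarrow> 'a"
    and r \<alpha> \<theta> :: real
    and \<beta> :: "nat \<Rightarrow> real"
    and z :: "nat \<Rightarrow> 'a"
    and zstar :: 'a
  assumes "monotone_operator V"
    and "continuous_on UNIV V"
    and "0 < r" and "r \<le> 1" and "0 < \<alpha>" and "0 < \<theta>"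
    and "r < 1 \<Longrightarrow> 2 / \<alpha> < \<theta>"
    and "r = 1 \<Longrightarrow> 2 / (\<alpha> + 1) \<le> \<theta> \<and> \<theta> < 1 / 4"
    and "\<And>k. 0 < \<beta> k"
    and "incseq \<beta>"
    and "\<exists>k0::nat. k0 \<ge> 1 \<and>
           (SUP k\<in>{k0..}. ereal (real k powr r * ((\<beta> k - \<beta> (k - 1)) / \<beta> k + 2 * r / real k)))
             < ereal (1 / (2 * \<theta>))"
    and "implicit_algorithm r \<alpha> \<theta> \<beta> V z"
    and "V zstar = 0"
  shows "(r < 1 \<longrightarrow>
            (\<forall>\<rho>. 0 < \<rho> \<and> \<rho> < r \<longrightarrow> convergence_rates V \<beta> r zstar z \<rho>) \<and>
            (bounded (z ` {2..}) \<longrightarrow> convergence_rates V \<beta> r zstar z r)) \<and>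
         (r = 1 \<longrightarrow>
            bounded (z ` {2..}) \<and> convergence_rates V \<beta> r zstar z 1)"
proof -
  \<comment> \<open>For r = 1, \<theta> (\<alpha> - 1) = \<theta> (\<alpha> + 1) - 2 \<theta> > 2 -
    1/2; for r < 1, even \<theta> \<alpha> > 2.\<close>
  have damping: "3 / 2 < \<theta> * (if r = 1 then \<alpha> - 1 else \<alpha>)"
  proof (cases "r = 1")
    case True
    then have "2 \<le> \<theta> * (\<alpha> + 1)" "\<theta> < 1 / 4" using assms(5,8) by (auto simp: field_simps)
    then show ?thesis using True by (simp add: algebra_simps)
  next
    case False
    then show ?thesis using assms(4,5,7) by (simp add: field_simps)
  qed
  obtain k0 where k0: "(SUP k\<in>{k0..}. ereal (real k powr r * ((\<beta> k - \<beta> (k - 1)) / \<beta> k + 2 * r / real k)))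
             < ereal (1 / (2 * \<theta>))" using assms(11) by blast
  have growth: "\<forall>\<^sub>F k in sequentially.
      \<theta> * (real k powr r * ((\<beta> k - \<beta> (k - 1)) / \<beta> k + 2 * r / real k)) < 1 / 2"
    using eventually_ge_at_top[of k0]
  proof eventually_elim
    case (elim k)
    then have "ereal (real k powr r * ((\<beta> k - \<beta> (k - 1)) / \<beta> k + 2 * r / real k)) < ereal (1 / (2 * \<theta>))"
      by (intro le_less_trans[OF SUP_upper k0]) auto
    then show ?case using assms(6) by (simp add: field_simps)
  qed
  interpret implicit_scheme V r \<alpha> \<theta> \<beta> z zstar
    by unfold_locales (fact assms damping growth)+
  have "bounded (z ` {2..})" using bounded_iterates by (rule bounded_subset) auto
  then show ?thesis using rates by auto
qed

end
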